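(* Let $T>0$, let $m\ge1$ be an integer, let $1>\alpha>\alpha_1>\alpha_2>\cdots>\alpha_m>0$, and let $f:[0,T]\times\mathbb R^{m+1}\to\mathbb R$ be continuous. Let $0\le r<1$ and $r<\alpha$. Consider the initial value problem $$D^\alpha x(t)=f\big(t,x(t),D^{\alpha_1}x(t),\dots,D^{\alpha_m}x(t)\big),\quad 0<t<T,\qquad x(0)=0, \tag{P}$$ and the fractional integral equation $$y(t)=f\big(t,I^\alpha y(t),I^{\alpha-\alpha_1}y(t),\dots,I^{\alpha-\alpha_m}y(t)\big),\quad 0<t<T. \tag{E}$$ (a) If $x$ is a solution of (P) with $D^\alpha x\in C_r[0,T]$, and $y(t)=D^\alpha x(t)$, then $y$ is a solution of (E). (b) If $y\in C_r[0,T]$ is a solution of (E) and $x(t):=I^\alpha y(t)$, then $x$ is a solution of (P).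
   Context: For $\beta>0$, $I^\beta y(t)=\frac1{\Gamma(\beta)}\int_0^t(t-\tau)^{\beta-1}y(\tau)\,d\tau$; for $0<\beta<1$, $D^\beta y(t)=\frac{d}{dt}\frac{1}{\Gamma(1-\beta)}\int_0^t(t-\tau)^{-\beta}y(\tau)\,d\tau$ is the Riemann–Liouville derivative. $L(0,T)$ is the space of Lebesgue integrable functions on $(0,T)$. A solution of (P) is a function $x\in C(0,T)\cap L(0,T)$ satisfying (P), with $D^\alpha x\in C(0,T)\cap L(0,T)$; the condition $x(0)=0$ means $\lim_{t\to0^+}x(t)=0$. For $0\le r<1$, $C_r[0,T]$ is the space of functions $g\in C(0,T)$ such that $t^r g(t)$ extends to a continuous function on $[0,T]$. *)

theory Defs
  imports "HOL-Analysis.Analysis"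
begin

text \<open>
  Functions on \<open>(0,T)\<close> are total functions \<open>real \<Rightarrow> real\<close> whose values outside the open interval
  play no role.
\<close>

definition RL_integral :: "real \<Rightarrow> (real \<Rightarrow> real) \<Rightarrow> real \<Rightarrow> real" where
  "RL_integral \<beta> y t =
     1 / Gamma \<beta> * (LINT \<tau>:{0<..<t}|lebesgue. (t - \<tau>) powr (\<beta> - 1) * y \<tau>)"

text \<open>
  The value of \<open>RL_deriv\<close> is meaningful only where \<open>RL_differentiable\<close> holds. Both are used only for
  functions in \<open>C(0,T) \<inter> L(0,T)\<close>, for which the integrals below converge absolutely at every
  \<open>t \<in> (0,T)\<close>.
\<close>

definition RL_differentiable :: "real \<Rightarrow> (real \<Rightarrow> real) \<Rightarrow> real \<Rightarrow> bool" where
  "RL_differentiable \<beta> y t \<longleftrightarrow> RL_integral (1 - \<beta>) y field_differentiable (at t)"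

definition RL_deriv :: "real \<Rightarrow> (real \<Rightarrow> real) \<Rightarrow> real \<Rightarrow> real" where
  "RL_deriv \<beta> y t = deriv (RL_integral (1 - \<beta>) y) t"

definition CL_space :: "real \<Rightarrow> (real \<Rightarrow> real) set" where
  "CL_space T = {g. continuous_on {0<..<T} g \<and> set_integrable lebesgue {0<..<T} g}"

definition C_weighted :: "real \<Rightarrow> real \<Rightarrow> (real \<Rightarrow> real) set" where
  "C_weighted r T = {g. continuous_on {0<..<T} g \<and>
     (\<exists>h. continuous_on {0..T} h \<and> (\<forall>t\<in>{0<..<T}. h t = t powr r * g t))}"

text \<open>
  The point \<open>(u, v 1, \<dots>, v m)\<close> of \<open>\<real>\<^sup>m\<^sup>+\<^sup>1\<close>, in the representation of \<^const>\<open>Euclidean_space\<close>: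
  coordinates are numbered from \<open>0\<close> and vanish from index \<open>m + 1\<close> on.
\<close>

definition arg_vec :: "nat \<Rightarrow> real \<Rightarrow> (nat \<Rightarrow> real) \<Rightarrow> (nat \<Rightarrow> real)" where
  "arg_vec m u v = (\<lambda>i. if i = 0 then u else if i \<le> m then v i else 0)"

definition solves_IVP ::
  "real \<Rightarrow> nat \<Rightarrow> real \<Rightarrow> (nat \<Rightarrow> real) \<Rightarrow> (real \<times> (nat \<Rightarrow> real) \<Rightarrow> real) \<Rightarrow> (real \<Rightarrow> real) \<Rightarrow> bool"
where
  "solves_IVP T m \<alpha> \<alpha>s f x \<longleftrightarrow>
     x \<in> CL_space T \<and>
     (\<forall>t\<in>{0<..<T}. RL_differentiable \<alpha> x t) \<and>
     RL_deriv \<alpha> x \<in> CL_space T \<and>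
     (\<forall>i\<in>{1..m}. \<forall>t\<in>{0<..<T}. RL_differentiable (\<alpha>s i) x t) \<and>
     (\<forall>t\<in>{0<..<T}. RL_deriv \<alpha> x t = f (t, arg_vec m (x t) (\<lambda>i. RL_deriv (\<alpha>s i) x t))) \<and>
     (x \<longlongrightarrow> 0) (at_right 0)"

definition solves_integral_eq ::
  "real \<Rightarrow> nat \<Rightarrow> real \<Rightarrow> (nat \<Rightarrow> real) \<Rightarrow> (real \<times> (nat \<Rightarrow> real) \<Rightarrow> real) \<Rightarrow> (real \<Rightarrow> real) \<Rightarrow> bool"
where
  "solves_integral_eq T m \<alpha> \<alpha>s f y \<longleftrightarrow>
     y \<in> CL_space T \<and>
     (\<forall>t\<in>{0<..<T}. y t =
        f (t, arg_vec m (RL_integral \<alpha> y t) (\<lambda>i. RL_integral (\<alpha> - \<alpha>s i) y t)))"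

end

theory Submission
  imports Defs
begin

text \<open>
  \<open>I\<^sup>a\<close> is convolution with \<open>k\<^sub>a(u) = u\<^sup>a\<^sup>-\<^sup>1 / \<Gamma>(a)\<close>, \<open>u > 0\<close>, and the Beta integral says
  \<open>k\<^sub>a * k\<^sub>b = k\<^sub>a\<^sub>+\<^sub>b\<close>; hence \<open>I\<^sup>a I\<^sup>b = I\<^sup>a\<^sup>+\<^sup>b\<close> by Fubini. If \<open>x = I\<^sup>\<alpha> y\<close>, then for \<open>\<beta> \<le> \<alpha>\<close> one has
  \<open>I\<^sup>1\<^sup>-\<^sup>\<beta> x = I\<^sup>1 I\<^sup>\<alpha>\<^sup>-\<^sup>\<beta> y\<close>, so that \<open>D\<^sup>\<beta> x = I\<^sup>\<alpha>\<^sup>-\<^sup>\<beta> y\<close> (and \<open>D\<^sup>\<alpha> x = y\<close>), and it remains to see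
  that \<open>x(0) = 0\<close> together with \<open>D\<^sup>\<alpha> x = y\<close> forces \<open>x = I\<^sup>\<alpha> y\<close>. The weight \<open>r < \<alpha>\<close> enters through
  \<open>|I\<^sup>b y(t)| \<le> C t\<^sup>b\<^sup>-\<^sup>r\<close>, which follows from \<open>k\<^sub>b * k\<^sub>1\<^sub>-\<^sub>r = k\<^sub>b\<^sub>+\<^sub>1\<^sub>-\<^sub>r\<close>.
\<close>

section \<open>Power kernels and their convolution\<close>

definition rl_kernel :: "real \<Rightarrow> real \<Rightarrow> real" where
  "rl_kernel a u = indicator {0<..} u * u powr (a - 1) / Gamma a"

lemma rl_kernel_measurable [measurable]: "rl_kernel a \<in> borel_measurable borel"
  unfolding rl_kernel_def by measurable

lemma rl_kernel_nonneg: "a > 0 \<Longrightarrow> 0 \<le> rl_kernel a u"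
  by (simp add: rl_kernel_def)

lemma rl_kernel_nonpos_arg: "u \<le> 0 \<Longrightarrow> rl_kernel a u = 0"
  by (simp add: rl_kernel_def)

lemma rl_kernel_pos_arg: "u > 0 \<Longrightarrow> rl_kernel a u = u powr (a - 1) / Gamma a"
  by (simp add: rl_kernel_def)

lemma rl_kernel_scale:
  assumes "c > 0"
  shows "rl_kernel a (c * u) = c powr (a - 1) * rl_kernel a u"
  using assms by (simp add: rl_kernel_def powr_mult zero_less_mult_iff indicator_def)

text \<open>For \<open>s < t\<close> the substitution \<open>\<tau> = s + c * u\<close> with
  \<open>c = t - s\<close> turns the integrand into a constant times the Beta integrand on
  \<open>{0..1}\<close>, and \<open>Beta b a = Gamma a * Gamma b / Gamma (a + b)\<close> produces
  the new kernel. For \<open>t \<le> s\<close> one of the two factors is always zero. Since the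
  integrand is nonnegative, its nonnegative integral yields integrability and the value at
  once.\<close>

lemma has_bochner_integral_rl_kernel_convolution:
  assumes "a > 0" "b > 0"
  shows "has_bochner_integral lborel (\<lambda>\<tau>. rl_kernel a (t - \<tau>) * rl_kernel b (\<tau> - s))
           (rl_kernel (a + b) (t - s))"
proof (cases "s < t")
  case False
  then have "rl_kernel a (t - \<tau>) * rl_kernel b (\<tau> - s) = 0" for \<tau>
    by (cases "t \<le> \<tau>") (auto simp: rl_kernel_nonpos_arg)
  then have "(\<lambda>\<tau>. rl_kernel a (t - \<tau>) * rl_kernel b (\<tau> - s)) = (\<lambda>_. 0)" by (rule ext)
  with False show ?thesis
    by (simp add: rl_kernel_nonpos_arg has_bochner_integral_zero)
next
  case True
  define c where "c = t - s"
  have c: "c > 0" using True by (simp add: c_def)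
  have G: "Gamma a > 0" "Gamma b > 0" "Gamma (a + b) > 0"
    using assms by (auto intro: Gamma_real_pos)
  let ?p = "\<lambda>u. u powr (b - 1) * (1 - u) powr (a - 1)"
  have beta: "(\<integral>\<^sup>+u. ennreal (indicator {0..1} u * ?p u) \<partial>lborel) = ennreal (Beta b a)"
    using nn_integral_has_integral_lebesgue[OF _ has_integral_Beta_real[OF assms(2,1)]] by simp
  have kernel_eq: "rl_kernel a (t - (s + c * u)) * rl_kernel b ((s + c * u) - s)
      = (c powr (a - 1) * c powr (b - 1) / (Gamma a * Gamma b)) * (indicator {0..1} u * ?p u)" for u
  proof -
    have "t - (s + c * u) = c * (1 - u)" by (simp add: c_def algebra_simps)
    then have "rl_kernel a (t - (s + c * u)) * rl_kernel b ((s + c * u) - s)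
       = c powr (a - 1) * c powr (b - 1) * (rl_kernel a (1 - u) * rl_kernel b u)"
      using rl_kernel_scale[OF c] by simp
    also have "rl_kernel a (1 - u) * rl_kernel b u = indicator {0..1} u * ?p u / (Gamma a * Gamma b)"
      by (auto simp: rl_kernel_def indicator_def)
    finally show ?thesis by simp
  qed
  have "(\<integral>\<^sup>+\<tau>. ennreal (rl_kernel a (t - \<tau>) * rl_kernel b (\<tau> - s)) \<partial>lborel)
      = ennreal \<bar>c\<bar> * (\<integral>\<^sup>+u. ennreal (rl_kernel a (t - (s + c * u)) * rl_kernel b ((s + c * u) - s)) \<partial>lborel)"
    using c by (intro nn_integral_real_affine) simp_all
  also have "\<dots> = ennreal c * (ennreal (c powr (a - 1) * c powr (b - 1) / (Gamma a * Gamma b)) * ennreal (Beta b a))"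
    unfolding kernel_eq beta[symmetric] using G c
    by (subst ennreal_mult') (simp_all add: nn_integral_cmult)
  also have "\<dots> = ennreal (c * (c powr (a - 1) * c powr (b - 1) / (Gamma a * Gamma b) * Beta b a))"
    using G c by (simp add: ennreal_mult[symmetric] Beta_def add.commute)
  \<comment> \<open>The Jacobian \<open>c\<close> is written as \<open>c powr 1\<close> so that the
    three powers merge into \<open>c powr (a + b - 1)\<close>.\<close>
  also have "c * (c powr (a - 1) * c powr (b - 1) / (Gamma a * Gamma b) * Beta b a)
      = (c powr 1 * c powr (a - 1) * c powr (b - 1)) / Gamma (a + b)"
    using G c by (simp add: Beta_def field_simps)
  also have "\<dots> = rl_kernel (a + b) (t - s)"
  proof -
    have "c powr 1 * c powr (a - 1) * c powr (b - 1) = c powr (1 + (a - 1) + (b - 1))"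
      by (simp only: powr_add)
    then show ?thesis using c by (simp add: rl_kernel_pos_arg c_def add_diff_eq)
  qed
  finally show ?thesis
    using assms by (intro has_bochner_integral_nn_integral) (auto simp: rl_kernel_nonneg)
qed

section \<open>Fractional integrals as convolutions and the semigroup law\<close>

lemma RL_integral_cong:
  assumes "\<And>s. 0 < s \<Longrightarrow> s < t \<Longrightarrow> y s = z s"
  shows "RL_integral a y t = RL_integral a z t"
  unfolding RL_integral_def set_lebesgue_integral_def
  by (intro arg_cong2[where f = "(*)"] Bochner_Integration.integral_cong refl)
     (auto simp: indicator_def assms)

lemma zero_extension_measurable:
  fixes y :: "real \<Rightarrow> real"
  assumes "continuous_on {0<..<T} y"
  shows "(\<lambda>s. indicator {0<..<T} s * y s) \<in> borel_measurable borel"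
  using borel_measurable_continuous_on_indicator[OF _ assms] by simp

text \<open>The kernel vanishes for \<open>s \<ge> t\<close>, so with \<open>t \<le> T\<close>
  cutting \<open>y\<close> off at \<open>T\<close> loses nothing. The zero extension of
  \<open>y\<close> is Borel measurable, which permits the passage from \<open>lebesgue\<close> to
  \<open>lborel\<close>, where Fubini and affine substitution are applied later.\<close>

lemma RL_integral_eq_convolution:
  assumes "continuous_on {0<..<T} y" "t \<le> T"
  shows "RL_integral a y t = (LINT s|lborel. rl_kernel a (t - s) * (indicator {0<..<T} s * y s))"
proof -
  note [measurable] = zero_extension_measurable[OF assms(1)]
  have "RL_integral a y t
      = (LINT s|lebesgue. rl_kernel a (t - s) * (indicator {0<..<T} s * y s))"
    unfolding RL_integral_def set_lebesgue_integral_def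
    by (subst integral_mult_right_zero[symmetric])
       (use assms(2) in \<open>intro Bochner_Integration.integral_cong; auto simp: indicator_def rl_kernel_def\<close>)
  also have "\<dots> = (LINT s|lborel. rl_kernel a (t - s) * (indicator {0<..<T} s * y s))"
    by (rule integral_completion) measurable
  finally show ?thesis .
qed

lemma CL_space_integrable_extension:
  assumes "y \<in> CL_space T"
  shows "integrable lborel (\<lambda>s. indicator {0<..<T} s * y s)"
proof -
  have "continuous_on {0<..<T} y" using assms by (simp add: CL_space_def)
  note [measurable] = zero_extension_measurable[OF this]
  show ?thesis
    using assms by (subst integrable_completion[symmetric]) (auto simp: CL_space_def set_integrable_def)
qed

text \<open>For \<open>a + b \<ge> 1\<close> the kernel \<open>k\<^sub>a\<^sub>+\<^sub>b\<close> is bounded, so integrability of \<open>y\<close> suffices for Fubini.\<close>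

lemma RL_integral_semigroup:
  assumes y: "y \<in> CL_space T" and t: "t \<le> T"
    and ab: "a > 0" "b > 0" "a + b \<ge> 1"
  shows "RL_integral a (RL_integral b y) t = RL_integral (a + b) y t"
proof -
  have cont: "continuous_on {0<..<T} y" using y by (simp add: CL_space_def)
  define g where "g s = indicator {0<..<T} s * y s" for s
  have g [measurable]: "g \<in> borel_measurable borel"
    using zero_extension_measurable[OF cont] by (simp add: g_def[abs_def])
  have g_int: "integrable lborel g"
    using CL_space_integrable_extension[OF y] by (simp add: g_def[abs_def])
  \<comment> \<open>The joint integrand: integrating out \<open>\<tau>\<close> collapses the two
    kernels into \<open>rl_kernel (a + b) (t - s)\<close>, while integrating out \<open>s\<close>
    gives the integrand of the iterated fractional integral.\<close>
  define K where "K = (\<lambda>(s, \<tau>). rl_kernel a (t - \<tau>) * rl_kernel b (\<tau> - s) * g s)"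
  note conv = has_bochner_integral_rl_kernel_convolution[OF ab(1,2)]
  have K_meas [measurable]: "K \<in> borel_measurable (lborel \<Otimes>\<^sub>M lborel)"
    unfolding K_def by measurable
  have K_integral: "(LINT \<tau>|lborel. K (s, \<tau>)) = rl_kernel (a + b) (t - s) * g s" for s
    using has_bochner_integral_integral_eq[OF conv] by (simp add: K_def)
  have K_norm: "(LINT \<tau>|lborel. norm (K (s, \<tau>))) = rl_kernel (a + b) (t - s) * norm (g s)" for s
    using has_bochner_integral_integral_eq[OF conv] ab
    by (simp add: K_def abs_mult rl_kernel_nonneg)
  have K_int: "integrable (lborel \<Otimes>\<^sub>M lborel) K"
  proof (rule lborel_pair.Fubini_integrable)
    show "AE s in lborel. integrable lborel (\<lambda>\<tau>. K (s, \<tau>))"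
      using conv by (auto simp: K_def has_bochner_integral_iff)
    have bound: "norm (rl_kernel (a + b) (t - s) * norm (g s))
        \<le> norm (T powr (a + b - 1) / Gamma (a + b) * g s)" for s
    proof (cases "0 < s \<and> s < t")
      case True
      then have "(t - s) powr (a + b - 1) \<le> T powr (a + b - 1)"
        using ab t by (intro powr_mono2) auto
      then show ?thesis
        using True ab Gamma_real_pos[of "a + b"]
        by (auto simp: rl_kernel_pos_arg abs_mult intro!: mult_right_mono divide_right_mono)
    next
      case False
      then show ?thesis
        by (auto simp: rl_kernel_nonpos_arg g_def)
    qed
    show "integrable lborel (\<lambda>s. LINT \<tau>|lborel. norm (K (s, \<tau>)))"
      unfolding K_norm
      by (rule Bochner_Integration.integrable_bound[OF _ _ AE_I2[OF bound]])
         (use g_int in auto)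
  qed fact
  have inner: "rl_kernel a (t - \<tau>) * RL_integral b y \<tau> = (LINT s|lborel. K (s, \<tau>))" for \<tau>
  proof (cases "\<tau> < t")
    case True
    have "(LINT s|lborel. K (s, \<tau>)) = rl_kernel a (t - \<tau>) * (LINT s|lborel. rl_kernel b (\<tau> - s) * g s)"
      unfolding K_def by (simp add: mult.assoc)
    then show ?thesis
      using RL_integral_eq_convolution[OF cont, of \<tau> b] True t by (simp add: g_def)
  qed (simp add: K_def rl_kernel_nonpos_arg)
  \<comment> \<open>For \<open>\<tau> \<le> 0\<close> the inner integral runs over an empty
    interval. With the kernel vanishing for \<open>\<tau> \<ge> t\<close>, this lets the outer
    integral extend from \<open>{0<..<t}\<close> to the whole line.\<close>
  have zero: "RL_integral b y \<tau> = 0" if "\<tau> \<le> 0" for \<tau>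
    using that by (simp add: RL_integral_def set_lebesgue_integral_def)
  have "RL_integral a (RL_integral b y) t
      = (LINT \<tau>|lebesgue. rl_kernel a (t - \<tau>) * RL_integral b y \<tau>)"
    unfolding RL_integral_def[of a] set_lebesgue_integral_def
    by (subst integral_mult_right_zero[symmetric])
       (use zero in \<open>intro Bochner_Integration.integral_cong; auto simp: indicator_def rl_kernel_def\<close>)
  also have "\<dots> = (LINT \<tau>|lborel. LINT s|lborel. K (s, \<tau>))"
    unfolding inner by (rule integral_completion) measurable
  also have "\<dots> = (LINT s|lborel. LINT \<tau>|lborel. K (s, \<tau>))"
    using K_int by (intro lborel_pair.Fubini_integral) simp
  also have "\<dots> = RL_integral (a + b) y t"
    unfolding K_integral using RL_integral_eq_convolution[OF cont t, of "a + b"] by (simp add: g_def)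
  finally show ?thesis .
qed

section \<open>Differentiating the integral of order one\<close>

text \<open>The function \<open>h\<close> may be unbounded near \<open>0\<close> and
  \<open>T\<close>, so the fundamental theorem of calculus is applied on a compact
  \<open>{c..d}\<close> inside the interval with \<open>t\<close> in its interior. The integral over
  \<open>{0..c}\<close> exists by integrability and contributes only a constant.\<close>

lemma RL_integral_1_has_derivative:
  assumes h: "h \<in> CL_space T" and t: "0 < t" "t < T"
  shows "(RL_integral 1 h has_field_derivative h t) (at t)"
proof -
  define c d where "c = t / 2" and "d = (t + T) / 2"
  have cd: "0 < c" "c < t" "t < d" "d < T" using t by (auto simp: c_def d_def)
  have cont: "continuous_on {c..d} h"
    using h cd by (auto simp: CL_space_def intro: continuous_on_subset)
  have eq: "RL_integral 1 h s = integral {0..c} h + integral {c..s} h" if s: "s \<in> {c<..<d}" for s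
  proof -
    have "set_integrable lebesgue {0<..<s} h"
      using h s cd unfolding CL_space_def by (auto intro: set_integrable_subset)
    moreover have "RL_integral 1 h s = (LINT \<tau>:{0<..<s}|lebesgue. h \<tau>)"
      unfolding RL_integral_def by (auto intro!: set_lebesgue_integral_cong)
    ultimately have "RL_integral 1 h s = integral {0<..<s} h" "h integrable_on {0<..<s}"
      using set_lebesgue_integral_eq_integral by auto
    then have "RL_integral 1 h s = integral {0..s} h" "h integrable_on {0..s}"
      using integral_open_interval_real[of 0 s h] integrable_on_open_interval_real[of h 0 s] by auto
    with s cd show ?thesis
      using Henstock_Kurzweil_Integration.integral_combine[of 0 c s h] by auto
  qed
  have "((\<lambda>s. integral {c..s} h) has_field_derivative h t) (at t within {c..d})"
    using integral_has_real_derivative[OF cont] cd by auto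
  then have "((\<lambda>s. integral {c..s} h) has_field_derivative h t) (at t)"
    using cd by (simp add: at_within_Icc_at)
  then have "((\<lambda>s. integral {0..c} h + integral {c..s} h) has_field_derivative h t) (at t)"
    by (auto intro!: derivative_eq_intros)
  then show ?thesis
    by (rule has_field_derivative_transform_within_open[where S = "{c<..<d}"]) (use eq cd in auto)
qed

section \<open>Weighted bounds and regularity of fractional integrals\<close>

lemma C_weighted_bound:
  assumes "y \<in> C_weighted r T"
  obtains M where "\<And>s. 0 < s \<Longrightarrow> s < T \<Longrightarrow> \<bar>y s\<bar> \<le> M * s powr (-r)"
proof -
  from assms obtain h where h: "continuous_on {0..T} h" "\<And>t. t \<in> {0<..<T} \<Longrightarrow> h t = t powr r * y t"
    by (auto simp: C_weighted_def)
  have "bounded (h ` {0..T})"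
    using h(1) by (intro compact_imp_bounded compact_continuous_image) auto
  then obtain M where M: "\<And>t. t \<in> {0..T} \<Longrightarrow> \<bar>h t\<bar> \<le> M"
    unfolding bounded_iff by fastforce
  show ?thesis
  proof
    fix s assume s: "0 < s" "s < T"
    then have "y s = h s * s powr (-r)" using h(2)[of s] by (simp add: powr_minus field_simps)
    with M[of s] s show "\<bar>y s\<bar> \<le> M * s powr (-r)"
      by (auto simp: abs_mult intro!: mult_right_mono)
  qed
qed

text \<open>The majorant \<open>s powr (-r)\<close> equals
  \<open>Gamma (1 - r) * rl_kernel (1 - r) s\<close> for \<open>s > 0\<close>, so the kernel
  convolution identity evaluates the majorizing integral exactly.\<close>

lemma RL_integral_power_bound:
  assumes cont: "continuous_on {0<..<T} y" and t: "t \<le> T"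
    and bound: "\<And>s. 0 < s \<Longrightarrow> s < t \<Longrightarrow> \<bar>y s\<bar> \<le> M * s powr (-r)"
    and "r < 1" "b > 0"
  shows "\<bar>RL_integral b y t\<bar> \<le> M * Gamma (1 - r) * rl_kernel (b + (1 - r)) t"
proof -
  define g where "g s = indicator {0<..<T} s * y s" for s
  have [measurable]: "g \<in> borel_measurable borel"
    using zero_extension_measurable[OF cont] by (simp add: g_def[abs_def])
  have G: "Gamma (1 - r) > 0" using assms by (intro Gamma_real_pos) auto
  let ?D = "\<lambda>s. M * Gamma (1 - r) * (rl_kernel b (t - s) * rl_kernel (1 - r) s)"
  have D: "has_bochner_integral lborel ?D (M * Gamma (1 - r) * rl_kernel (b + (1 - r)) t)"
    using has_bochner_integral_rl_kernel_convolution[of b "1 - r" t 0] assms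
    by (intro has_bochner_integral_mult_right) auto
  then have D_int: "integrable lborel ?D" by (simp only: has_bochner_integral_iff)
  have le: "\<bar>rl_kernel b (t - s) * g s\<bar> \<le> ?D s" for s
  proof (cases "0 < s \<and> s < t")
    case True
    then have "\<bar>g s\<bar> \<le> M * (Gamma (1 - r) * rl_kernel (1 - r) s)"
      using bound[of s] t G by (simp add: g_def rl_kernel_pos_arg)
    from mult_left_mono[OF this rl_kernel_nonneg[OF \<open>b > 0\<close>, of "t - s"]] show ?thesis
      using \<open>b > 0\<close> by (simp add: abs_mult rl_kernel_nonneg mult_ac)
  next
    case False
    then show ?thesis by (auto simp: g_def rl_kernel_nonpos_arg)
  qed
  have "integrable lborel (\<lambda>s. rl_kernel b (t - s) * g s)"
    by (rule Bochner_Integration.integrable_bound[OF D_int])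
       (use le in \<open>auto intro!: AE_I2 order_trans[OF _ abs_ge_self]\<close>)
  then have "\<bar>LINT s|lborel. rl_kernel b (t - s) * g s\<bar> \<le> integral\<^sup>L lborel ?D"
    using D le by (intro order_trans[OF integral_abs_bound] integral_mono)
      (auto simp: has_bochner_integral_iff)
  then show ?thesis
    unfolding has_bochner_integral_integral_eq[OF D]
    using RL_integral_eq_convolution[OF cont t, of b] by (simp add: g_def)
qed

text \<open>
  Scaling \<open>s = t u\<close> moves the dependence on \<open>t\<close> from the singular kernel into the continuous
  function \<open>y\<close>, so that dominated convergence applies.
\<close>

lemma continuous_on_RL_integral:
  assumes cont: "continuous_on {0<..<T} y"
    and bound: "\<And>s. 0 < s \<Longrightarrow> s < T \<Longrightarrow> \<bar>y s\<bar> \<le> M * s powr (-r)"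
    and "r < 1" "b > 0"
  shows "continuous_on {0<..<T} (RL_integral b y)"
proof -
  define g where "g s = indicator {0<..<T} s * y s" for s
  have [measurable]: "g \<in> borel_measurable borel"
    using zero_extension_measurable[OF cont] by (simp add: g_def[abs_def])
  define J where "J t = (LINT u|lborel. rl_kernel b (1 - u) * g (t * u))" for t
  have scaled: "RL_integral b y t = t * t powr (b - 1) * J t" if "t \<in> {0<..<T}" for t
  proof -
    have "RL_integral b y t = (LINT s|lborel. rl_kernel b (t - s) * g s)"
      using RL_integral_eq_convolution[OF cont, of t b] that by (simp add: g_def)
    also have "\<dots> = \<bar>t\<bar> *\<^sub>R (LINT u|lborel. rl_kernel b (t - (0 + t * u)) * g (0 + t * u))"
      using that by (intro lborel_integral_real_affine) auto
    also have "(\<lambda>u. rl_kernel b (t - (0 + t * u)) * g (0 + t * u))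
        = (\<lambda>u. t powr (b - 1) * (rl_kernel b (1 - u) * g (t * u)))"
      using that rl_kernel_scale[of t b "1 - _"] by (simp add: right_diff_distrib fun_eq_iff)
    finally show ?thesis using that by (simp add: J_def)
  qed
  have G: "Gamma (1 - r) > 0" using assms by (intro Gamma_real_pos) auto
  have "continuous_on {0<..<T} J"
  proof (rule continuous_on_sequentiallyI)
    fix v t assume v: "\<forall>n. v n \<in> {0<..<T}" and t: "t \<in> {0<..<T}" and lim: "v \<longlonglongrightarrow> t"
    \<comment> \<open>As the limit \<open>t\<close> is positive, these powers converge and are
      therefore bounded by some \<open>K\<close>. This makes the dominating function below
      independent of \<open>n\<close>; its integrability is the kernel convolution at
      \<open>t = 1\<close>, \<open>s = 0\<close>.\<close>
    have "(\<lambda>n. v n powr (-r)) \<longlonglongrightarrow> t powr (-r)"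
      using lim t by (intro tendsto_intros) auto
    then obtain K where K: "\<And>n. v n powr (-r) \<le> K"
      by (metis Bseq_def convergentI convergent_imp_Bseq real_norm_def abs_le_D1)
    let ?w = "\<lambda>u. \<bar>M\<bar> * K * Gamma (1 - r) * (rl_kernel b (1 - u) * rl_kernel (1 - r) u)"
    have w: "integrable lborel ?w"
      using has_bochner_integral_rl_kernel_convolution[of b "1 - r" 1 0] assms
      by (auto simp: has_bochner_integral_iff)
    have dom: "norm (rl_kernel b (1 - u) * g (v n * u)) \<le> ?w u" for n u
    proof (cases "0 < u \<and> u < 1")
      case True
      have vn: "0 < v n" "v n < T" using v by auto
      then have "v n * u < T * 1"
        using True by (intro mult_strict_mono) auto
      with vn True have "\<bar>g (v n * u)\<bar> \<le> M * (v n * u) powr (-r)"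
        using bound[of "v n * u"] by (simp add: g_def)
      also have "\<dots> \<le> \<bar>M\<bar> * (K * u powr (-r))"
        using vn True K[of n] by (auto simp: powr_mult intro!: mult_mono)
      finally have "\<bar>g (v n * u)\<bar> \<le> \<bar>M\<bar> * K * Gamma (1 - r) * rl_kernel (1 - r) u"
        using True G by (simp add: rl_kernel_pos_arg)
      from mult_left_mono[OF this rl_kernel_nonneg[OF \<open>b > 0\<close>, of "1 - u"]] show ?thesis
        using \<open>b > 0\<close> by (simp add: abs_mult rl_kernel_nonneg mult_ac)
    next
      case False
      with v[rule_format, of n] show ?thesis
        by (auto simp: g_def rl_kernel_nonpos_arg zero_less_mult_iff)
    qed
    have conv: "(\<lambda>n. rl_kernel b (1 - u) * g (v n * u)) \<longlonglongrightarrow> rl_kernel b (1 - u) * g (t * u)" for u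
    proof (cases "0 < u \<and> u < 1")
      case True
      have in_range: "p * u \<in> {0<..<T}" if "p \<in> {0<..<T}" for p
        using that True mult_strict_mono[of p T u 1] by auto
      have "(\<lambda>n. y (v n * u)) \<longlonglongrightarrow> y (t * u)"
        using v t in_range by (intro continuous_on_tendsto_compose[OF cont] tendsto_intros lim) auto
      then have "(\<lambda>n. g (v n * u)) \<longlonglongrightarrow> g (t * u)"
        using in_range v t by (simp add: g_def)
      then show ?thesis by (intro tendsto_intros)
    next
      \<comment> \<open>For \<open>u \<ge> 1\<close> the kernel vanishes and for
        \<open>u \<le> 0\<close> the extension \<open>g\<close> does, so continuity of
        \<open>y\<close> on the open interval suffices.\<close>
      case False
      have "rl_kernel b (1 - u) * g (p * u) = 0" if "p \<in> {0<..<T}" for p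
        using False that by (auto simp: g_def rl_kernel_nonpos_arg zero_less_mult_iff)
      then have "(\<lambda>n. rl_kernel b (1 - u) * g (v n * u)) = (\<lambda>_. 0)" "rl_kernel b (1 - u) * g (t * u) = 0"
        using v t by fast+
      then show ?thesis by (simp only: tendsto_const)
    qed
    show "(\<lambda>n. J (v n)) \<longlonglongrightarrow> J t"
      unfolding J_def
      by (rule integral_dominated_convergence[where w = ?w]) (use w dom conv in auto)
  qed
  then have "continuous_on {0<..<T} (\<lambda>t. t * t powr (b - 1) * J t)"
    by (intro continuous_intros) auto
  then show ?thesis
    by (rule continuous_on_eq) (simp add: scaled)
qed

text \<open>The power bound gives a constant multiple of \<open>t powr (b - r)\<close> as majorant.
  It is integrable because \<open>b > 0\<close> and \<open>r < 1\<close> make the exponent exceed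
  \<open>-1\<close>; measurability comes from continuity.\<close>

lemma RL_integral_in_CL_space:
  assumes cont: "continuous_on {0<..<T} y"
    and bound: "\<And>s. 0 < s \<Longrightarrow> s < T \<Longrightarrow> \<bar>y s\<bar> \<le> M * s powr (-r)"
    and "r < 1" "b > 0"
  shows "RL_integral b y \<in> CL_space T"
proof -
  have cont': "continuous_on {0<..<T} (RL_integral b y)"
    using assms by (rule continuous_on_RL_integral)
  define C where "C = M * Gamma (1 - r) / Gamma (b + (1 - r))"
  have "set_integrable lebesgue {0<..<T} (\<lambda>t. C * t powr (b - r))"
  proof (cases "T > 0")
    case True
    then have "(\<lambda>t. t powr (b - r)) absolutely_integrable_on {0<..T}"
      using assms by (intro nonnegative_absolutely_integrable_1 integrable_on_powr_from_0') auto
    then have "(\<lambda>t. t powr (b - r)) absolutely_integrable_on {0<..<T}"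
      by (rule set_integrable_subset) auto
    then show ?thesis by (rule set_integrable_mult_right)
  qed (simp add: set_integrable_def)
  moreover have "set_borel_measurable lebesgue {0<..<T} (RL_integral b y)"
    unfolding set_borel_measurable_def
    by (rule measurable_completion) (use zero_extension_measurable[OF cont'] in simp)
  moreover have "norm (RL_integral b y t) \<le> norm (C * t powr (b - r))" if "t \<in> {0<..<T}" for t
  proof -
    have "\<bar>RL_integral b y t\<bar> \<le> M * Gamma (1 - r) * rl_kernel (b + (1 - r)) t"
      using that assms by (intro RL_integral_power_bound[OF cont]) auto
    also have "\<dots> = C * t powr (b - r)"
      using that by (simp add: rl_kernel_pos_arg C_def)
    finally show ?thesis by simp
  qed
  ultimately have "set_integrable lebesgue {0<..<T} (RL_integral b y)"
    by (rule set_integrable_bound[OF _ _ AE_I2[OF impI]])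
  with cont' show ?thesis by (simp add: CL_space_def)
qed

text \<open>The majorant \<open>C * t powr (b - r)\<close> tends to \<open>0\<close> because
  \<open>r < b\<close>. The estimate on \<open>y\<close> is asked for only on
  \<open>{0<..<d}\<close>, which covers functions known to be bounded merely near
  \<open>0\<close>.\<close>

lemma RL_integral_tendsto_0:
  assumes cont: "continuous_on {0<..<T} y" and d: "0 < d" "d \<le> T"
    and bound: "\<And>s. 0 < s \<Longrightarrow> s < d \<Longrightarrow> \<bar>y s\<bar> \<le> M * s powr (-r)"
    and "r < 1" "0 < b" "r < b"
  shows "(RL_integral b y \<longlongrightarrow> 0) (at_right 0)"
proof (rule Lim_null_comparison)
  define C where "C = M * Gamma (1 - r) / Gamma (b + (1 - r))"
  show "\<forall>\<^sub>F t in at_right 0. norm (RL_integral b y t) \<le> C * t powr (b - r)"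
    unfolding eventually_at_right_field
  proof (intro exI conjI allI impI)
    fix t assume t: "0 < t" "t < d"
    then have "\<bar>RL_integral b y t\<bar> \<le> M * Gamma (1 - r) * rl_kernel (b + (1 - r)) t"
      using assms by (intro RL_integral_power_bound[OF cont]) auto
    also have "\<dots> = C * t powr (b - r)"
      using t by (simp add: rl_kernel_pos_arg C_def)
    finally show "norm (RL_integral b y t) \<le> C * t powr (b - r)" by simp
  qed (use d in simp)
  have "((\<lambda>t::real. C * t powr (b - r)) \<longlongrightarrow> C * 0 powr (b - r)) (at_right 0)"
    using assms by (intro tendsto_intros tendsto_powr') (auto simp: eventually_at_right_field intro: exI[of _ 1])
  then show "((\<lambda>t. C * t powr (b - r)) \<longlongrightarrow> 0) (at_right 0)" by simp
qed

section \<open>Fractional derivatives and integrals as inverse operations\<close>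

text \<open>The semigroup law turns \<open>RL_integral a x\<close> into
  \<open>RL_integral (a + b) y\<close>; once this is written as \<open>RL_integral 1 z\<close>, its
  derivative is \<open>z\<close>. The intended instance for a derivative of order
  \<open>\<beta>\<close> is \<open>a = 1 - \<beta>\<close>, \<open>b = \<alpha>\<close>.\<close>

lemma has_derivative_RL_integral_of_RL_integral:
  assumes y: "y \<in> CL_space T" and z: "z \<in> CL_space T"
    and ab: "a > 0" "b > 0" "a + b \<ge> 1"
    and x: "\<And>t. 0 < t \<Longrightarrow> t < T \<Longrightarrow> x t = RL_integral b y t"
    and eq: "\<And>t. 0 < t \<Longrightarrow> t < T \<Longrightarrow> RL_integral (a + b) y t = RL_integral 1 z t"
    and t: "0 < t" "t < T"
  shows "(RL_integral a x has_field_derivative z t) (at t)"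
proof (rule has_field_derivative_transform_within_open[where S = "{0<..<T}"])
  show "(RL_integral 1 z has_field_derivative z t) (at t)"
    using z t by (rule RL_integral_1_has_derivative)
  fix s assume s: "s \<in> {0<..<T}"
  then have "RL_integral a x s = RL_integral a (RL_integral b y) s"
    by (intro RL_integral_cong) (auto simp: x)
  also have "\<dots> = RL_integral (a + b) y s"
    using s by (intro RL_integral_semigroup[OF y] ab) auto
  finally show "RL_integral 1 z s = RL_integral a x s"
    using eq s by simp
qed (use t in auto)

text \<open>This is the case \<open>z = y\<close>, since the orders \<open>1 - \<alpha>\<close> and
  \<open>\<alpha>\<close> add up to \<open>1\<close>.\<close>

lemma RL_deriv_RL_integral:
  assumes y: "y \<in> CL_space T" and "0 < \<alpha>" "\<alpha> < 1"
    and x: "\<And>t. 0 < t \<Longrightarrow> t < T \<Longrightarrow> x t = RL_integral \<alpha> y t"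
    and t: "0 < t" "t < T"
  shows "RL_differentiable \<alpha> x t" "RL_deriv \<alpha> x t = y t"
proof -
  have "(RL_integral (1 - \<alpha>) x has_field_derivative y t) (at t)"
    using assms by (intro has_derivative_RL_integral_of_RL_integral[where b = \<alpha> and y = y and T = T]) auto
  then show "RL_differentiable \<alpha> x t" "RL_deriv \<alpha> x t = y t"
    by (auto simp: RL_differentiable_def RL_deriv_def field_differentiable_def DERIV_imp_deriv)
qed

text \<open>Here \<open>z = RL_integral (\<alpha> - \<beta>) y\<close>: the total order
  \<open>1 - \<beta> + \<alpha>\<close> splits as \<open>1 + (\<alpha> - \<beta>)\<close>.\<close>

lemma RL_deriv_RL_integral_less:
  assumes y: "y \<in> CL_space T" "RL_integral (\<alpha> - \<beta>) y \<in> CL_space T"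
    and "0 < \<beta>" "\<beta> < \<alpha>" "\<alpha> < 1"
    and x: "\<And>t. 0 < t \<Longrightarrow> t < T \<Longrightarrow> x t = RL_integral \<alpha> y t"
    and t: "0 < t" "t < T"
  shows "RL_differentiable \<beta> x t" "RL_deriv \<beta> x t = RL_integral (\<alpha> - \<beta>) y t"
proof -
  have "RL_integral (1 - \<beta> + \<alpha>) y s = RL_integral 1 (RL_integral (\<alpha> - \<beta>) y) s" if "s < T" for s
    using RL_integral_semigroup[OF y(1), of s 1 "\<alpha> - \<beta>"] that assms by (simp add: algebra_simps)
  then have "(RL_integral (1 - \<beta>) x has_field_derivative RL_integral (\<alpha> - \<beta>) y t) (at t)"
    using assms by (intro has_derivative_RL_integral_of_RL_integral[where b = \<alpha> and y = y and T = T]) auto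
  then show "RL_differentiable \<beta> x t" "RL_deriv \<beta> x t = RL_integral (\<alpha> - \<beta>) y t"
    by (auto simp: RL_differentiable_def RL_deriv_def field_differentiable_def DERIV_imp_deriv)
qed

text \<open>
  Both \<open>I\<^sup>1\<^sup>-\<^sup>\<alpha> x\<close> and \<open>I\<^sup>1 y\<close> vanish at \<open>0\<close> and have derivative \<open>y\<close>, so they agree; applying \<open>I\<^sup>\<alpha>\<close>
  gives \<open>I\<^sup>1 x = I\<^sup>1 I\<^sup>\<alpha> y\<close>, which is then differentiated.
\<close>

lemma RL_integral_RL_deriv:
  assumes x: "x \<in> CL_space T" "(x \<longlongrightarrow> 0) (at_right 0)"
    and diff: "\<And>t. 0 < t \<Longrightarrow> t < T \<Longrightarrow> RL_differentiable \<alpha> x t"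
    and y: "y \<in> CL_space T" "\<And>t. 0 < t \<Longrightarrow> t < T \<Longrightarrow> y t = RL_deriv \<alpha> x t"
    and bound: "\<And>s. 0 < s \<Longrightarrow> s < T \<Longrightarrow> \<bar>y s\<bar> \<le> M * s powr (-r)"
    and "0 < \<alpha>" "\<alpha> < 1" "r < 1" and t: "0 < t" "t < T"
  shows "x t = RL_integral \<alpha> y t"
proof -
  have cont: "continuous_on {0<..<T} x" "continuous_on {0<..<T} y"
    using x y by (auto simp: CL_space_def)
  let ?d = "\<lambda>s. RL_integral (1 - \<alpha>) x s - RL_integral 1 y s"
  have "\<exists>c. \<forall>s\<in>{0<..<T}. ?d s = c"
  proof (rule has_field_derivative_zero_constant)
    fix s assume s: "s \<in> {0<..<T}"
    have "(RL_integral (1 - \<alpha>) x has_field_derivative y s) (at s)"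
      using diff[of s] y(2)[of s] s
      by (simp add: RL_differentiable_def RL_deriv_def field_differentiable_derivI)
    moreover have "(RL_integral 1 y has_field_derivative y s) (at s)"
      using s by (intro RL_integral_1_has_derivative[OF y(1)]) auto
    ultimately have "(?d has_field_derivative y s - y s) (at s)"
      by (rule DERIV_diff)
    then show "(?d has_field_derivative 0) (at s within {0<..<T})"
      by (simp add: has_field_derivative_at_within)
  qed simp
  then obtain c where c: "\<And>s. 0 < s \<Longrightarrow> s < T \<Longrightarrow> ?d s = c" by auto
  have "(?d \<longlongrightarrow> 0 - 0) (at_right 0)"
  proof (rule tendsto_diff)
    have "\<forall>\<^sub>F s in at_right 0. \<bar>x s\<bar> < 1"
      using tendstoD[OF x(2), of 1] by simp
    then obtain e where e: "e > 0" "\<And>s. 0 < s \<Longrightarrow> s < e \<Longrightarrow> \<bar>x s\<bar> < 1"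
      by (auto simp: eventually_at_right_field)
    show "(RL_integral (1 - \<alpha>) x \<longlongrightarrow> 0) (at_right 0)"
    \<comment> \<open>The initial condition makes \<open>x\<close> bounded by \<open>1\<close> near
      \<open>0\<close>, so the unweighted case \<open>r = 0\<close> applies there and the positive
      order \<open>1 - \<alpha>\<close> suffices.\<close>
    proof (rule RL_integral_tendsto_0[OF cont(1), where d = "min e T" and M = 1 and r = 0])
      show "\<bar>x s\<bar> \<le> 1 * s powr (- 0)" if "0 < s" "s < min e T" for s
        using e(2)[of s] that by simp
    qed (use e assms in auto)
    \<comment> \<open>For \<open>y\<close> only the weighted bound is at hand; the order
      \<open>1\<close> exceeds \<open>r\<close>.\<close>
    show "(RL_integral 1 y \<longlongrightarrow> 0) (at_right 0)"
      using assms by (intro RL_integral_tendsto_0[OF cont(2), where d = T and M = M and r = r]) auto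
  qed
  moreover have "\<forall>\<^sub>F s in at_right 0. ?d s = c"
    using c t by (auto simp: eventually_at_right_field intro!: exI[of _ T])
  ultimately have "((\<lambda>_. c) \<longlongrightarrow> 0) (at_right (0::real))"
    by (simp add: tendsto_cong)
  then have "c = 0" by (simp add: tendsto_const_iff)
  have z: "RL_integral (1 - \<alpha>) x s = RL_integral 1 y s" if "0 < s" "s < T" for s
    using c[OF that] \<open>c = 0\<close> by simp
  have eq: "RL_integral 1 (RL_integral \<alpha> y) s = RL_integral 1 x s" if "0 < s" "s < T" for s
  proof -
    \<comment> \<open>Both sides equal \<open>RL_integral (1 + \<alpha>) y s\<close>. The swap
      brings \<open>RL_integral 1 y\<close> inside, where \<open>z\<close> replaces it.\<close>
    have "RL_integral 1 (RL_integral \<alpha> y) s = RL_integral \<alpha> (RL_integral 1 y) s"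
      using RL_integral_semigroup[OF y(1), of s 1 \<alpha>] RL_integral_semigroup[OF y(1), of s \<alpha> 1] that assms
      by (simp add: add.commute)
    also have "\<dots> = RL_integral \<alpha> (RL_integral (1 - \<alpha>) x) s"
      using z that by (intro RL_integral_cong) auto
    also have "\<dots> = RL_integral 1 x s"
      using RL_integral_semigroup[OF x(1), of s \<alpha> "1 - \<alpha>"] that assms by simp
    finally show ?thesis .
  qed
  \<comment> \<open>The weighted bound makes \<open>RL_integral \<alpha> y\<close> continuous and
    integrable, so its integral of order one can be differentiated at every \<open>t\<close> and the
    identity holds pointwise.\<close>
  have "RL_integral \<alpha> y \<in> CL_space T"
    using assms by (intro RL_integral_in_CL_space[OF cont(2), where M = M and r = r]) auto
  then have "(RL_integral 1 (RL_integral \<alpha> y) has_field_derivative RL_integral \<alpha> y t) (at t)"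
    using t by (rule RL_integral_1_has_derivative)
  then have "(RL_integral 1 x has_field_derivative RL_integral \<alpha> y t) (at t)"
    by (rule has_field_derivative_transform_within_open[where S = "{0<..<T}"]) (use eq t in auto)
  moreover have "(RL_integral 1 x has_field_derivative x t) (at t)"
    using x(1) t by (rule RL_integral_1_has_derivative)
  ultimately show ?thesis by (rule DERIV_unique[symmetric])
qed

section \<open>Passing between the initial value problem and the integral equation\<close>

lemma CL_space_cong:
  assumes "\<And>t. 0 < t \<Longrightarrow> t < T \<Longrightarrow> x t = y t"
  shows "x \<in> CL_space T \<longleftrightarrow> y \<in> CL_space T"
proof -
  have "continuous_on {0<..<T} x \<longleftrightarrow> continuous_on {0<..<T} y"
    using assms by (intro continuous_on_cong) auto
  moreover have "set_integrable lebesgue {0<..<T} x \<longleftrightarrow> set_integrable lebesgue {0<..<T} y"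
    using assms by (intro set_integrable_cong) auto
  ultimately show ?thesis by (simp add: CL_space_def)
qed

theorem lemma2:
  fixes T \<alpha> r :: real and m :: nat and \<alpha>s :: "nat \<Rightarrow> real"
    and f :: "real \<times> (nat \<Rightarrow> real) \<Rightarrow> real"
  assumes "T > 0" and "m \<ge> 1"
    and "\<alpha> < 1" and "\<alpha>s 1 < \<alpha>"
    and "\<And>i. 1 \<le> i \<Longrightarrow> i < m \<Longrightarrow> \<alpha>s (Suc i) < \<alpha>s i"
    and "0 < \<alpha>s m"
    and "continuous_map (prod_topology (top_of_set {0..T}) (Euclidean_space (Suc m))) euclideanreal f"
    and "0 \<le> r" and "r < 1" and "r < \<alpha>"
  shows "(\<forall>x y. solves_IVP T m \<alpha> \<alpha>s f x \<longrightarrow> RL_deriv \<alpha> x \<in> C_weighted r T \<longrightarrow>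
            (\<forall>t\<in>{0<..<T}. y t = RL_deriv \<alpha> x t) \<longrightarrow> solves_integral_eq T m \<alpha> \<alpha>s f y)
       \<and> (\<forall>x y. y \<in> C_weighted r T \<longrightarrow> solves_integral_eq T m \<alpha> \<alpha>s f y \<longrightarrow>
            (\<forall>t\<in>{0<..<T}. x t = RL_integral \<alpha> y t) \<longrightarrow> solves_IVP T m \<alpha> \<alpha>s f x)"
proof -
  \<comment> \<open>Comparing index \<open>i\<close> with \<open>1\<close> and with \<open>m\<close>
    places every order \<open>\<alpha>s i\<close> strictly between \<open>0\<close> and
    \<open>\<alpha>\<close>.\<close>
  have antimono: "\<alpha>s j \<le> \<alpha>s i" if "1 \<le> i" "i \<le> j" "j \<le> m" for i j
    using that(2,3)
  proof (induction j rule: dec_induct)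
    case (step n)
    then show ?case using assms(5)[of n] \<open>1 \<le> i\<close> by simp
  qed simp
  have order: "0 < \<alpha>s i \<and> \<alpha>s i < \<alpha>" if "i \<in> {1..m}" for i
    using antimono[of 1 i] antimono[of i m] that assms(4,6) by auto
  from order[of 1] have \<alpha>: "0 < \<alpha>" using \<open>m \<ge> 1\<close> by simp
  have a: "solves_integral_eq T m \<alpha> \<alpha>s f y"
    if sol: "solves_IVP T m \<alpha> \<alpha>s f x" and weighted: "RL_deriv \<alpha> x \<in> C_weighted r T"
      and y: "\<forall>t\<in>{0<..<T}. y t = RL_deriv \<alpha> x t" for x y
  proof -
    obtain M where M: "\<And>s. 0 < s \<Longrightarrow> s < T \<Longrightarrow> \<bar>RL_deriv \<alpha> x s\<bar> \<le> M * s powr (-r)"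
      using C_weighted_bound[OF weighted] by blast
    have yM: "\<bar>y s\<bar> \<le> M * s powr (-r)" if "0 < s" "s < T" for s
      using M[OF that] y that by simp
    have yCL: "y \<in> CL_space T"
      using sol y CL_space_cong[of T y "RL_deriv \<alpha> x"] by (auto simp: solves_IVP_def)
    then have cont: "continuous_on {0<..<T} y" by (simp add: CL_space_def)
    \<comment> \<open>The initial condition enters here, recovering \<open>x\<close> from its
      derivative.\<close>
    have x: "x t = RL_integral \<alpha> y t" if "0 < t" "t < T" for t
      using sol y yCL yM \<alpha> assms(3,9) that
      by (intro RL_integral_RL_deriv[where M = M and r = r and T = T]) (auto simp: solves_IVP_def)
    have ICL: "RL_integral b y \<in> CL_space T" if "0 < b" for b
      by (rule RL_integral_in_CL_space[OF cont _ \<open>r < 1\<close> that]) (rule yM)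
    have "RL_deriv (\<alpha>s i) x t = RL_integral (\<alpha> - \<alpha>s i) y t" if "i \<in> {1..m}" "t \<in> {0<..<T}" for i t
      using that order[OF that(1)] assms(3) yCL x ICL[of "\<alpha> - \<alpha>s i"]
      by (intro RL_deriv_RL_integral_less[where T = T]) auto
    \<comment> \<open>Beyond coordinate \<open>0\<close>, \<open>arg_vec\<close> reads its second
      argument only at indices \<open>1\<close> to \<open>m\<close>, exactly where the derivative
      formula is available.\<close>
    then have "arg_vec m (x t) (\<lambda>i. RL_deriv (\<alpha>s i) x t)
        = arg_vec m (RL_integral \<alpha> y t) (\<lambda>i. RL_integral (\<alpha> - \<alpha>s i) y t)" if "t \<in> {0<..<T}" for t
      using x that by (auto simp: arg_vec_def fun_eq_iff)
    then show ?thesis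
      using sol y yCL by (simp add: solves_IVP_def solves_integral_eq_def)
  qed
  have b: "solves_IVP T m \<alpha> \<alpha>s f x"
    if weighted: "y \<in> C_weighted r T" and sol: "solves_integral_eq T m \<alpha> \<alpha>s f y"
      and x: "\<forall>t\<in>{0<..<T}. x t = RL_integral \<alpha> y t" for x y
  proof -
    obtain M where M: "\<And>s. 0 < s \<Longrightarrow> s < T \<Longrightarrow> \<bar>y s\<bar> \<le> M * s powr (-r)"
      using C_weighted_bound[OF weighted] by blast
    have yCL: "y \<in> CL_space T" using sol by (simp add: solves_integral_eq_def)
    then have cont: "continuous_on {0<..<T} y" by (simp add: CL_space_def)
    have ICL: "RL_integral b y \<in> CL_space T" if "0 < b" for b
      by (rule RL_integral_in_CL_space[OF cont _ \<open>r < 1\<close> that]) (rule M)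
    have x': "x t = RL_integral \<alpha> y t" if "0 < t" "t < T" for t using x that by simp
    have top: "RL_differentiable \<alpha> x t" "RL_deriv \<alpha> x t = y t" if "t \<in> {0<..<T}" for t
      using RL_deriv_RL_integral[OF yCL \<alpha> \<open>\<alpha> < 1\<close>, of x t] x' that by auto
    have lower: "RL_differentiable (\<alpha>s i) x t" "RL_deriv (\<alpha>s i) x t = RL_integral (\<alpha> - \<alpha>s i) y t"
      if "i \<in> {1..m}" "t \<in> {0<..<T}" for i t
      using that order[OF that(1)] assms(3) ICL[of "\<alpha> - \<alpha>s i"]
        RL_deriv_RL_integral_less[of y T \<alpha> "\<alpha>s i" x t] yCL x' by auto
    have "x \<in> CL_space T"
      using CL_space_cong[of T x "RL_integral \<alpha> y"] x' ICL[OF \<alpha>] by simp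
    moreover have "RL_deriv \<alpha> x \<in> CL_space T"
      using CL_space_cong[of T "RL_deriv \<alpha> x" y] top yCL by simp
    moreover have "(x \<longlongrightarrow> 0) (at_right 0)"
    proof -
      \<comment> \<open>The hypothesis \<open>r < \<alpha>\<close> makes the exponent
        \<open>\<alpha> - r\<close> of the bound positive, which yields the initial
        condition.\<close>
      have "(RL_integral \<alpha> y \<longlongrightarrow> 0) (at_right 0)"
        using assms(1,9,10) \<alpha> M by (intro RL_integral_tendsto_0[OF cont, where d = T and M = M and r = r]) auto
      moreover have "\<forall>\<^sub>F t in at_right 0. x t = RL_integral \<alpha> y t"
        using x' \<open>T > 0\<close> by (auto simp: eventually_at_right_field)
      ultimately show ?thesis by (simp add: tendsto_cong)
    qed
    moreover have "arg_vec m (x t) (\<lambda>i. RL_deriv (\<alpha>s i) x t)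
        = arg_vec m (RL_integral \<alpha> y t) (\<lambda>i. RL_integral (\<alpha> - \<alpha>s i) y t)" if "t \<in> {0<..<T}" for t
      using x lower that by (auto simp: arg_vec_def fun_eq_iff)
    ultimately show ?thesis
      using sol top lower by (simp add: solves_IVP_def solves_integral_eq_def)
  qed
  show ?thesis using a b by blast
qed

end
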